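(* Let $\theta_0\in[0,2\pi)$ be the true phase, let $(Z,X)$ be the data of a two-stage protocol with Stage I window $W(Z)$, coverage set $\mathcal C_{\theta_0}=\{z:\theta_0\in W(z)\}$, and overshoot $\Delta_{\theta_0}(z)=\operatorname{dist}_{\mathbb S^1}(\theta_0,W(z))$ (all as defined in the context). Let $\hat\theta=\hat\theta(Z,X)$ be an estimator with $\hat\theta(Z,X)\in W(Z)$ $\mathbb P_{\theta_0}$-almost surely. Suppose that for $\mathbb P^Z_{\theta_0}$-almost every $z\in\mathcal C_{\theta_0}$: (1) the conditional Stage II model $\{p_{2,z}(x;\vartheta):\vartheta\in I_z\}$ is regular in a neighborhood of $\tilde\theta_0$ (in the sense given in the context); (2) the lifted estimator $\widetilde{\hat\theta}_z$ is locally unbiased at $\tilde\theta_0$; (3) the conditional Fisher information satisfies $0<\mathcal I_2(\theta_0;z)<\infty$. Then $$\mathbb E_{\theta_0}\big[d(\hat\theta(Z,X),\theta_0)^2\big]\ \ge\ \mathbb E_{\theta_0}\!\left[\frac{\mathbf 1_{\mathcal C_{\theta_0}}(Z)}{\mathcal I_2(\theta_0;Z)}\right]+\mathbb E_{\theta_0}\big[\Delta_{\theta_0}(Z)^2\big],$$ where the quotient is understood to be $0$ when $Z\notin\mathcal C_{\theta_0}$.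
   Context: Angles are points of $\mathbb S^1=\mathbb R/2\pi\mathbb Z$, represented in $[0,2\pi)$. The geodesic distance is $d(\vartheta,\theta)=\min_{k\in\mathbb Z}|\vartheta-\theta+2\pi k|\in[0,\pi]$, and $\operatorname{dist}_{\mathbb S^1}(\theta,W)=\inf_{\vartheta\in W}d(\vartheta,\theta)$. Two-stage protocol. Stage I produces a random outcome $Z$ in a measurable space $\mathcal Z$, whose law under phase $\theta_0$ is $\mathbb P^Z_{\theta_0}$. From it one computes a measurable coarse estimate $\hat\theta_1(Z)\in[0,2\pi)$ and the window $W(Z)=[\hat\theta_1(Z)-\pi/4,\hat\theta_1(Z)+\pi/4]\subset\mathbb S^1$ (the closed arc of length $\pi/2$ centred at $\hat\theta_1(Z)$). Stage II then produces a random outcome $X$ whose conditional law given $Z=z$ depends on the phase and on $z$. $\mathbb P_{\theta_0},\mathbb E_{\theta_0}$ refer to the joint law of $(Z,X)$ under phase $\theta_0$. An estimator $\hat\theta$ is a measurable $\mathbb S^1$-valued function of $(Z,X)$. Lift. Let $\pi_{\mathbb S^1}:\mathbb R\to\mathbb S^1$ be the quotient map and $\tilde\theta_0\in[0,2\pi)$ the representative of $\theta_0$. For $z\in\mathcal C_{\theta_0}$, let $I_z\subset\mathbb R$ be the connected component of $\pi_{\mathbb S^1}^{-1}(W(z))$ containing $\tilde\theta_0$; it is an interval of length $\pi/2$ mapped bijectively onto $W(z)$. When $\hat\theta(z,x)\in W(z)$, $\widetilde{\hat\theta}_z(x)\in I_z$ denotes its unique lift. Conditional model. For $z\in\mathcal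 C_{\theta_0}$ and $\vartheta\in I_z$, the conditional law of $X$ given $Z=z$ when the phase is $\pi_{\mathbb S^1}(\vartheta)$ has density $p_{2,z}(x;\vartheta)$ with respect to a measure $\mu_z$ not depending on $\vartheta$; $\mathbb E_{\vartheta,z}$ denotes expectation under $p_{2,z}(\cdot;\vartheta)$. The conditional Fisher information is $$\mathcal I_2(\theta_0;z)=\mathbb E_{\tilde\theta_0,z}\Big[\big(\partial_\vartheta\log p_{2,z}(X;\vartheta)|_{\vartheta=\tilde\theta_0}\big)^2\Big].$$ Regularity in a neighborhood of $\tilde\theta_0$ means the usual Cramér–Rao regularity conditions: the densities are dominated by the common measure $\mu_z$, have common support (the set where they are positive does not depend on $\vartheta$), are differentiable in $\vartheta$, and differentiation under the integral sign is valid, i.e. $\partial_\vartheta\int p_{2,z}\,d\mu_z=\int\partial_\vartheta p_{2,z}\,d\mu_z$ and $\partial_\vartheta\int\widetilde{\hat\theta}_z\,p_{2,z}\,d\mu_z=\int\widetilde{\hat\theta}_z\,\partial_\vartheta p_{2,z}\,d\mu_z$ (neighborhoods and derivatives are taken within $I_z$). Local unbiasedness at $\tilde\theta_0$ means $\mathbb E_{\tilde\theta_0,z}[\widetilde{\hat\theta}_z]=\tilde\theta_0$ and $\frac{d}{d\vartheta}\mathbb E_{\vartheta,z}[\widetilde{\hat\theta}_z]\big|_{\vartheta=\tilde\theta_0}=1$. *)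

theory Defs
  imports "HOL-Probability.Probability" "HOL-Library.Real_Mod"
begin

text \<open>
  Points of the circle \<open>\<real>/2\<pi>\<int>\<close> are given by their representatives in \<open>[0, 2\<pi>)\<close>, and the quotient
  map sends a real number to its representative. The bijection with the representatives
  identifies the Borel sets of the circle with the Borel subsets of \<open>[0, 2\<pi>)\<close>.
\<close>

definition circle :: "real set" where
  "circle = {0..<2 * pi}"

definition circle_borel :: "real measure" where
  "circle_borel = restrict_space borel circle"

definition circle_proj :: "real \<Rightarrow> real" where
  "circle_proj t = t rmod (2 * pi)"

(* The infimum over the integers is attained, so it is the minimum. *)
definition geo_dist :: "real \<Rightarrow> real \<Rightarrow> real" where
  "geo_dist \<phi> \<theta> = (INF k::int. \<bar>\<phi> - \<theta> + 2 * pi * of_int k\<bar>)"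

definition geo_setdist :: "real \<Rightarrow> real set \<Rightarrow> real" where
  "geo_setdist \<theta> W = (INF \<phi>\<in>W. geo_dist \<phi> \<theta>)"

subsection \<open>Two-stage protocols\<close>

text \<open>
  \<open>PZ \<theta>\<close> is the law of the Stage I outcome under phase \<open>\<theta>\<close>, the Markov kernel \<open>K \<theta>\<close> is the
  conditional law of the Stage II outcome given the Stage I outcome, and \<open>\<theta>1\<close> is the coarse
  estimate.
\<close>

definition two_stage_protocol ::
  "'z measure \<Rightarrow> 'x measure \<Rightarrow> (real \<Rightarrow> 'z measure) \<Rightarrow> (real \<Rightarrow> 'z \<Rightarrow> 'x measure) \<Rightarrow> ('z \<Rightarrow> real) \<Rightarrow> bool"
where
  "two_stage_protocol MZ MX PZ K \<theta>1 \<longleftrightarrow>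
     (\<forall>\<theta>\<in>circle. PZ \<theta> \<in> space (prob_algebra MZ)) \<and>
     (\<forall>\<theta>\<in>circle. K \<theta> \<in> MZ \<rightarrow>\<^sub>M prob_algebra MX) \<and>
     \<theta>1 \<in> MZ \<rightarrow>\<^sub>M circle_borel"

definition joint_law ::
  "'z measure \<Rightarrow> 'x measure \<Rightarrow> (real \<Rightarrow> 'z measure) \<Rightarrow> (real \<Rightarrow> 'z \<Rightarrow> 'x measure) \<Rightarrow> real \<Rightarrow> ('z \<times> 'x) measure"
where
  "joint_law MZ MX PZ K \<theta> = PZ \<theta> \<bind> (\<lambda>z. distr (K \<theta> z) (MZ \<Otimes>\<^sub>M MX) (Pair z))"

definition window :: "('z \<Rightarrow> real) \<Rightarrow> 'z \<Rightarrow> real set" where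
  "window \<theta>1 z = circle_proj ` {\<theta>1 z - pi / 4 .. \<theta>1 z + pi / 4}"

definition coverage :: "'z measure \<Rightarrow> ('z \<Rightarrow> real) \<Rightarrow> real \<Rightarrow> 'z set" where
  "coverage MZ \<theta>1 \<theta>0 = {z \<in> space MZ. \<theta>0 \<in> window \<theta>1 z}"

definition overshoot :: "('z \<Rightarrow> real) \<Rightarrow> real \<Rightarrow> 'z \<Rightarrow> real" where
  "overshoot \<theta>1 \<theta>0 z = geo_setdist \<theta>0 (window \<theta>1 z)"

definition lift_interval :: "('z \<Rightarrow> real) \<Rightarrow> real \<Rightarrow> 'z \<Rightarrow> real set" where
  "lift_interval \<theta>1 \<theta>0 z = connected_component_set (circle_proj -` window \<theta>1 z) \<theta>0"

(* Meaningful only where the estimate lies in the window; elsewhere it is an arbitrary constant. *)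
definition lifted_estimator ::
  "('z \<Rightarrow> real) \<Rightarrow> ('z \<times> 'x \<Rightarrow> real) \<Rightarrow> real \<Rightarrow> 'z \<Rightarrow> 'x \<Rightarrow> real" where
  "lifted_estimator \<theta>1 est \<theta>0 z x =
     the_inv_into (lift_interval \<theta>1 \<theta>0 z) circle_proj (est (z, x))"

subsection \<open>The conditional Stage II model\<close>

text \<open>
  The density of the conditional model at outcome \<open>x\<close> and parameter \<open>t\<close> is \<open>p z x t\<close>. Its
  parameter ranges over the lifted window.
\<close>

definition conditional_model ::
  "'z measure \<Rightarrow> 'x measure \<Rightarrow> (real \<Rightarrow> 'z \<Rightarrow> 'x measure) \<Rightarrow> ('z \<Rightarrow> real) \<Rightarrow> real
     \<Rightarrow> ('z \<Rightarrow> 'x measure) \<Rightarrow> ('z \<Rightarrow> 'x \<Rightarrow> real \<Rightarrow> real) \<Rightarrow> bool"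
where
  "conditional_model MZ MX K \<theta>1 \<theta>0 \<mu> p \<longleftrightarrow>
     (\<forall>z\<in>coverage MZ \<theta>1 \<theta>0.
        sets (\<mu> z) = sets MX \<and>
        (\<forall>t\<in>lift_interval \<theta>1 \<theta>0 z.
           (\<lambda>x. p z x t) \<in> borel_measurable (\<mu> z) \<and>
           (\<forall>x\<in>space (\<mu> z). 0 \<le> p z x t) \<and>
           K (circle_proj t) z = density (\<mu> z) (\<lambda>x. ennreal (p z x t))))"

text \<open>
  Derivatives in the parameter are taken within the parameter interval \<open>I\<close>, hence are one-sided
  at its end points.
\<close>

definition diff_under_integral ::
  "'x measure \<Rightarrow> ('x \<Rightarrow> real \<Rightarrow> real) \<Rightarrow> real set \<Rightarrow> ('x \<Rightarrow> real) \<Rightarrow> real \<Rightarrow> bool"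
where
  "diff_under_integral \<mu> p I g t \<longleftrightarrow>
     integrable \<mu> (\<lambda>x. g x * vector_derivative (p x) (at t within I)) \<and>
     ((\<lambda>s. \<integral>x. g x * p x s \<partial>\<mu>) has_real_derivative
        (\<integral>x. g x * vector_derivative (p x) (at t within I) \<partial>\<mu>)) (at t within I)"

definition cramer_rao_regular ::
  "'x measure \<Rightarrow> ('x \<Rightarrow> real \<Rightarrow> real) \<Rightarrow> real set \<Rightarrow> ('x \<Rightarrow> real) \<Rightarrow> real \<Rightarrow> bool"
where
  "cramer_rao_regular \<mu> p I T t0 \<longleftrightarrow>
     (\<exists>U. openin (top_of_set I) U \<and> t0 \<in> U \<and>
        (\<forall>t\<in>U. {x \<in> space \<mu>. 0 < p x t} = {x \<in> space \<mu>. 0 < p x t0}) \<and>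
        (\<forall>x\<in>space \<mu>. \<forall>t\<in>U. p x differentiable (at t within I)) \<and>
        (\<forall>t\<in>U. diff_under_integral \<mu> p I (\<lambda>_. 1) t) \<and>
        (\<forall>t\<in>U. diff_under_integral \<mu> p I T t))"

definition locally_unbiased ::
  "'x measure \<Rightarrow> ('x \<Rightarrow> real \<Rightarrow> real) \<Rightarrow> real set \<Rightarrow> ('x \<Rightarrow> real) \<Rightarrow> real \<Rightarrow> bool"
where
  "locally_unbiased \<mu> p I T t0 \<longleftrightarrow>
     (\<integral>x. T x \<partial>density \<mu> (\<lambda>x. ennreal (p x t0))) = t0 \<and>
     ((\<lambda>t. \<integral>x. T x \<partial>density \<mu> (\<lambda>x. ennreal (p x t))) has_real_derivative 1) (at t0 within I)"

definition fisher_info :: "'x measure \<Rightarrow> ('x \<Rightarrow> real \<Rightarrow> real) \<Rightarrow> real set \<Rightarrow> real \<Rightarrow> ennreal" where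
  "fisher_info \<mu> p I t0 =
     (\<integral>\<^sup>+ x. ennreal ((vector_derivative (\<lambda>t. ln (p x t)) (at t0 within I))\<^sup>2)
        \<partial>density \<mu> (\<lambda>x. ennreal (p x t0)))"

end

theory Submission
  imports Defs
begin

text \<open>
  Condition on the Stage I outcome \<open>z\<close>. If the window misses \<open>\<theta>0\<close>, an estimate in the window is at
  distance at least the overshoot from \<open>\<theta>0\<close>. If it covers \<open>\<theta>0\<close>, the overshoot vanishes, and the
  lifted window has length \<open>pi / 2 \<le> pi\<close>, so the circular error equals the error of the lifted
  estimator, to which the Cramer-Rao inequality applies: the score \<open>S\<close> satisfies
  \<open>E[(T - \<theta>0) S] = 1\<close>, and Cauchy-Schwarz gives \<open>1 \<le> E[(T - \<theta>0)^2] E[S^2]\<close>. Nothing makes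
  \<open>1 / fisher_info\<close> measurable in \<open>z\<close>, so its integral is a lower integral, and the pointwise bound
  is integrated for measurable minorants only.
\<close>

section \<open>Geometry of the window\<close>

lemma circle_proj_eq_iff: "circle_proj s = circle_proj t \<longleftrightarrow> (\<exists>n::int. t = s + 2 * pi * of_int n)"
  using rcong_altdef[of s t "2 * pi"] by (simp add: circle_proj_def rcong_def mult.commute)

lemma circle_proj_in_circle: "circle_proj t \<in> circle"
  by (simp add: circle_proj_def circle_def rmod_less rmod_nonneg)

lemma circle_proj_idem: "t \<in> circle \<Longrightarrow> circle_proj t = t"
  by (simp add: circle_proj_def circle_def)

lemma geo_dist_nonneg: "0 \<le> geo_dist s t"
  unfolding geo_dist_def by (rule cINF_greatest) auto

lemma geo_dist_refl [simp]: "geo_dist t t = 0"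
proof -
  have "geo_dist t t \<le> \<bar>t - t + 2 * pi * of_int 0\<bar>"
    unfolding geo_dist_def by (rule cINF_lower) (auto intro: bdd_belowI[of _ 0])
  then show ?thesis using geo_dist_nonneg[of t t] by simp
qed

text \<open>Any other representative of the angle of \<open>s\<close> differs from \<open>s\<close>
  by a nonzero multiple of \<open>2 * pi\<close>, and such a shift turns a difference of size at
  most \<open>pi\<close> into one of size at least \<open>pi\<close>.\<close>

lemma abs_diff_le_geo_dist_circle_proj:
  assumes "\<bar>s - t\<bar> \<le> pi"
  shows "\<bar>s - t\<bar> \<le> geo_dist (circle_proj s) t"
  unfolding geo_dist_def
proof (rule cINF_greatest)
  fix k :: int
  obtain n :: int where n: "s = circle_proj s + 2 * pi * of_int n"
    using circle_proj_eq_iff[of "circle_proj s" s] circle_proj_idem[OF circle_proj_in_circle] by auto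
  define j where "j = k - n"
  have eq: "circle_proj s - t + 2 * pi * of_int k = s - t + 2 * pi * of_int j"
    using n by (simp add: j_def algebra_simps)
  show "\<bar>s - t\<bar> \<le> \<bar>circle_proj s - t + 2 * pi * of_int k\<bar>"
  proof (cases "j = 0")
    case False
    then have "1 \<le> \<bar>real_of_int j\<bar>" by linarith
    then have "2 * pi * 1 \<le> 2 * pi * \<bar>real_of_int j\<bar>"
      by (intro mult_left_mono) auto
    then have "2 * pi \<le> \<bar>2 * pi * real_of_int j\<bar>" by (simp add: abs_mult)
    then show ?thesis unfolding eq using assms by linarith
  qed (simp add: eq)
qed auto

lemma geo_setdist_le: "u \<in> W \<Longrightarrow> geo_setdist t W \<le> geo_dist u t"
  unfolding geo_setdist_def
  by (rule cINF_lower) (auto intro!: bdd_belowI[of _ 0] geo_dist_nonneg)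

lemma geo_setdist_nonneg: "W \<noteq> {} \<Longrightarrow> 0 \<le> geo_setdist t W"
  unfolding geo_setdist_def by (rule cINF_greatest) (auto intro: geo_dist_nonneg)

lemma window_nonempty: "window \<theta>1 z \<noteq> {}"
  by (simp add: window_def)

lemma overshoot_nonneg: "0 \<le> overshoot \<theta>1 \<theta>0 z"
  by (simp add: overshoot_def geo_setdist_nonneg window_nonempty)

lemma overshoot_eq_0: "\<theta>0 \<in> window \<theta>1 z \<Longrightarrow> overshoot \<theta>1 \<theta>0 z = 0"
  using geo_setdist_le[of \<theta>0 "window \<theta>1 z" \<theta>0] overshoot_nonneg[of \<theta>1 \<theta>0 z]
  by (simp add: overshoot_def)

text \<open>Some translate by a multiple of \<open>2 * pi\<close> of the interval defining the
  window contains \<open>\<theta>0\<close>. Being connected, it lies in the component; the gaps on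
  both sides keep the component from extending further.\<close>

lemma lift_interval_eq_Icc:
  assumes "\<theta>0 \<in> circle" "\<theta>0 \<in> window \<theta>1 z"
  obtains a where "\<theta>0 \<in> {a..a + pi / 2}" "lift_interval \<theta>1 \<theta>0 z = {a..a + pi / 2}"
    "circle_proj ` {a..a + pi / 2} = window \<theta>1 z"
proof -
  obtain s where s: "s \<in> {\<theta>1 z - pi / 4 .. \<theta>1 z + pi / 4}" "\<theta>0 = circle_proj s"
    using assms(2) by (auto simp: window_def)
  then obtain n :: int where n: "\<theta>0 = s + 2 * pi * of_int n"
    using circle_proj_eq_iff[of s \<theta>0] circle_proj_idem[OF assms(1)] by auto
  \<comment> \<open>\<open>n\<close> carries \<open>s\<close>, a point of the interval around
    \<open>\<theta>1 z\<close>, to \<open>\<theta>0\<close>, so \<open>a\<close> is the left end of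
    the translate that contains \<open>\<theta>0\<close>.\<close>
  define a where "a = \<theta>1 z - pi / 4 + 2 * pi * of_int n"
  have \<theta>0: "\<theta>0 \<in> {a..a + pi / 2}" using s(1) n by (auto simp: a_def)
  have shift: "circle_proj (t + 2 * pi * of_int n) = circle_proj t" for t
    using circle_proj_eq_iff[of t "t + 2 * pi * of_int n"] by auto
  have "{a..a + pi / 2} = (\<lambda>t. t + 2 * pi * of_int n) ` {\<theta>1 z - pi / 4 .. \<theta>1 z + pi / 4}"
    by (simp add: a_def add_ac)
  then have img: "circle_proj ` {a..a + pi / 2} = window \<theta>1 z"
    unfolding window_def by (simp only: image_image shift)
  let ?S = "lift_interval \<theta>1 \<theta>0 z"
  have S_conn: "connected ?S" by (simp add: lift_interval_def)
  have S_sub: "circle_proj t \<in> window \<theta>1 z" if "t \<in> ?S" for t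
    using that connected_component_subset unfolding lift_interval_def by blast
  have sub: "{a..a + pi / 2} \<subseteq> ?S"
    unfolding lift_interval_def by (rule connected_component_maximal) (use \<theta>0 img in auto)
  \<comment> \<open>Consecutive components of the preimage of the window are separated by gaps of length \<open>3 * pi / 2\<close>.\<close>
  have gap: "t \<notin> ?S" if "a - pi \<le> t \<and> t < a \<or> a + pi / 2 < t \<and> t \<le> a + 3 * pi / 2" for t
  proof
    assume "t \<in> ?S"
    then obtain u where u: "u \<in> {a..a + pi / 2}" "circle_proj t = circle_proj u"
      using S_sub img by fastforce
    then obtain j :: int where j: "u = t + 2 * pi * of_int j"
      using circle_proj_eq_iff by blast
    have "j = 0"
    proof (rule ccontr)
      assume "j \<noteq> 0"
      then have "1 \<le> \<bar>real_of_int j\<bar>" by linarith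
      then have "2 * pi * 1 \<le> 2 * pi * \<bar>real_of_int j\<bar>"
        by (intro mult_left_mono) auto
      then have "2 * pi \<le> \<bar>2 * pi * real_of_int j\<bar>" by (simp add: abs_mult)
      \<comment> \<open>In both gap regions \<open>t\<close> and \<open>u\<close> are at most
        \<open>3 * pi / 2\<close> apart.\<close>
      moreover have "\<bar>u - t\<bar> < 2 * pi"
        using u(1) that pi_gt_zero by (auto simp del: pi_gt_zero)
      ultimately show False using j by simp
    qed
    then show False using u(1) j that by auto
  qed
  have "t \<in> {a..a + pi / 2}" if t: "t \<in> ?S" for t
  proof (rule ccontr)
    assume "t \<notin> {a..a + pi / 2}"
    then consider "t < a" | "a + pi / 2 < t" by fastforce
    then show False
    proof cases
      case 1
      \<comment> \<open>A connected set containing \<open>t\<close> and the arc contains all points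
        in between. Truncating at \<open>a - pi\<close> brings a distant \<open>t\<close> into the
        strip that \<open>gap\<close> excludes.\<close>
      have "max t (a - pi) \<in> ?S"
        by (rule connectedD_interval[OF S_conn t]) (use \<theta>0 sub 1 in auto)
      then show False using gap[of "max t (a - pi)"] 1 pi_gt_zero by linarith
    next
      case 2
      have "min t (a + 3 * pi / 2) \<in> ?S"
        by (rule connectedD_interval[OF S_conn _ t]) (use \<theta>0 sub 2 in auto)
      then show False using gap[of "min t (a + 3 * pi / 2)"] 2 pi_gt_zero by linarith
    qed
  qed
  then have "?S = {a..a + pi / 2}" using sub by blast
  then show ?thesis using that \<theta>0 img by blast
qed

section \<open>Injectivity and measurability of the lift\<close>

lemma inj_on_circle_proj:
  assumes "c < 2 * pi"
  shows "inj_on circle_proj {a..a + c}"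
proof (rule inj_onI)
  fix s t assume st: "s \<in> {a..a + c}" "t \<in> {a..a + c}" "circle_proj s = circle_proj t"
  then obtain j :: int where j: "t = s + 2 * pi * of_int j"
    using circle_proj_eq_iff by blast
  have "2 * pi * \<bar>real_of_int j\<bar> = \<bar>t - s\<bar>" using j by (simp add: abs_mult)
  also have "\<dots> < 2 * pi * 1" using st assms by auto
  finally have "\<bar>real_of_int j\<bar> < 1" by simp
  then show "s = t" using j by auto
qed

text \<open>\<open>circle_proj (t - a)\<close> is the offset of \<open>t\<close> from the left end
  of the arc, measured in \<open>[0, 2 * pi)\<close>. The closed form gives access to
  measurability.\<close>

lemma the_inv_into_circle_proj:
  assumes "c < 2 * pi" "t \<in> circle_proj ` {a..a + c}"
  shows "the_inv_into {a..a + c} circle_proj t = a + circle_proj (t - a)"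
proof -
  obtain s where s: "s \<in> {a..a + c}" "t = circle_proj s" using assms(2) by auto
  then obtain n :: int where "t = s + 2 * pi * of_int n"
    using circle_proj_eq_iff[of s t] circle_proj_idem[OF circle_proj_in_circle] by auto
  then have "circle_proj (t - a) = circle_proj (s - a)"
    unfolding circle_proj_eq_iff by (intro exI[of _ "- n"]) simp
  also have "\<dots> = s - a" using s(1) assms(1) by (intro circle_proj_idem) (auto simp: circle_def)
  finally show ?thesis
    using the_inv_into_f_f[OF inj_on_circle_proj[OF assms(1)] s(1)] s(2) by simp
qed

text \<open>Replaces an image by a condition on a Borel function, which makes the arc a Borel
  set.\<close>

lemma circle_proj_image_Icc:
  assumes "c < 2 * pi"
  shows "circle_proj ` {a..a + c} = {t \<in> circle. circle_proj (t - a) \<le> c}"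
proof (intro equalityI subsetI)
  fix t assume "t \<in> circle_proj ` {a..a + c}"
  then show "t \<in> {t \<in> circle. circle_proj (t - a) \<le> c}"
    using the_inv_into_into[OF inj_on_circle_proj[OF assms] _ subset_refl, of t a]
      the_inv_into_circle_proj[OF assms, of t a] circle_proj_in_circle by auto
next
  fix t assume t: "t \<in> {t \<in> circle. circle_proj (t - a) \<le> c}"
  obtain n :: int where "t - a = circle_proj (t - a) + 2 * pi * of_int n"
    using circle_proj_eq_iff[of "circle_proj (t - a)" "t - a"]
      circle_proj_idem[OF circle_proj_in_circle] by auto
  then have "circle_proj (a + circle_proj (t - a)) = circle_proj t"
    unfolding circle_proj_eq_iff by (intro exI[of _ n]) simp
  then have "t = circle_proj (a + circle_proj (t - a))"
    using t circle_proj_idem by simp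
  then show "t \<in> circle_proj ` {a..a + c}"
    using t circle_proj_in_circle[of "t - a"] by (intro image_eqI) (auto simp: circle_def)
qed

lemma borel_measurable_circle_proj [measurable]: "circle_proj \<in> borel_measurable borel"
  unfolding circle_proj_def[abs_def] rmod_def by measurable

text \<open>The infimum runs over a countable set, the integers.\<close>

lemma borel_measurable_geo_dist [measurable]: "(\<lambda>t. geo_dist t s) \<in> borel_measurable borel"
  unfolding geo_dist_def by measurable

lemma borel_measurable_the_inv_into_circle_proj:
  assumes "c < 2 * pi"
  shows "the_inv_into {a..a + c} circle_proj \<in> borel_measurable borel"
proof -
  have [measurable]: "circle_proj ` {a..a + c} \<in> sets borel"
    unfolding circle_proj_image_Icc[OF assms] circle_def by measurable
  \<comment> \<open>Off the arc no lift exists, and the description operator returns one and the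
    same default value at all such points.\<close>
  have "(THE s. s \<in> {a..a + c} \<and> circle_proj s = t) = (THE s. False)"
    if "t \<notin> circle_proj ` {a..a + c}" for t
    by (rule arg_cong[where f = The]) (use that in auto)
  then have "the_inv_into {a..a + c} circle_proj =
      (\<lambda>t. if t \<in> circle_proj ` {a..a + c} then a + circle_proj (t - a) else (THE s. False))"
    using the_inv_into_circle_proj[OF assms] by (auto simp: fun_eq_iff the_inv_into_def)
  moreover have "(\<lambda>t. if t \<in> circle_proj ` {a..a + c} then a + circle_proj (t - a)
      else (THE s. False)) \<in> borel_measurable borel"
    by measurable
  ultimately show ?thesis by simp
qed

section \<open>The Cramer-Rao inequality\<close>

text \<open>Common support leaves two cases: \<open>q\<close> is positive at \<open>t0\<close> and
  the chain rule applies, or \<open>q\<close> vanishes on all of \<open>U\<close>. In the second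
  case the conventions \<open>ln 0 = 0\<close> and \<open>x / 0 = 0\<close> make both sides 0.
  \<open>nontriv\<close> makes derivatives within \<open>I\<close> unique.\<close>

lemma vector_derivative_ln_within:
  assumes nontriv: "at t0 within I \<noteq> bot"
    and U: "openin (top_of_set I) U" "t0 \<in> U"
    and supp: "\<And>t. t \<in> U \<Longrightarrow> 0 < q t \<longleftrightarrow> 0 < q t0"
    and nonneg: "\<And>t. t \<in> U \<Longrightarrow> (0::real) \<le> q t"
    and diff: "q differentiable (at t0 within I)"
  shows "vector_derivative (\<lambda>t. ln (q t)) (at t0 within I) =
      vector_derivative q (at t0 within I) / q t0"
    and "q t0 = 0 \<Longrightarrow> vector_derivative q (at t0 within I) = 0"
proof -
  let ?D = "vector_derivative q (at t0 within I)"
  have ev: "eventually (\<lambda>t. t \<in> U) (at t0 within I)"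
    using U unfolding openin_open eventually_at_topological by blast
  have D: "(q has_vector_derivative ?D) (at t0 within I)"
    using diff vector_derivative_works by blast
  \<comment> \<open>Used with \<open>h\<close> the identity, for the derivative of \<open>q\<close>,
    and with \<open>h = ln\<close>, for the score.\<close>
  have zero: "vector_derivative f (at t0 within I) = 0"
    if "q t0 = 0" "\<And>t. t \<in> U \<Longrightarrow> f t = h (q t)" "h 0 = (0::real)" for f h
  proof -
    have "q t = 0" if "t \<in> U" for t
      using supp[OF that] nonneg[OF that] \<open>q t0 = 0\<close> by auto
    then have f0: "f t = 0" if "t \<in> U" for t using that \<open>\<And>t. t \<in> U \<Longrightarrow> f t = h (q t)\<close> \<open>h 0 = 0\<close> by simp
    have "((\<lambda>_. 0) has_vector_derivative 0) (at t0 within I)" by simp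
    then have "(f has_vector_derivative 0) (at t0 within I)"
      unfolding has_vector_derivative_def
      by (rule has_derivative_transform_eventually) (use ev f0 U subsetD[OF openin_imp_subset[OF U(1)] U(2)] in \<open>auto elim: eventually_mono\<close>)
    then show ?thesis by (rule vector_derivative_within[OF nontriv])
  qed
  show D0: "?D = 0" if "q t0 = 0" using zero[of q "\<lambda>y. y"] that by simp
  show "vector_derivative (\<lambda>t. ln (q t)) (at t0 within I) = ?D / q t0"
  proof (cases "q t0 = 0")
    case True
    then show ?thesis using zero[of _ ln] by simp
  next
    case False
    then have "0 < q t0" using nonneg U by force
    then have "((\<lambda>t. ln (q t)) has_real_derivative ?D / q t0) (at t0 within I)"
      using D by (auto intro!: derivative_eq_intros simp: has_real_derivative_iff_has_vector_derivative[symmetric])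
    then show ?thesis
      by (intro vector_derivative_within[OF nontriv])
        (simp add: has_real_derivative_iff_has_vector_derivative)
  qed
qed

lemma has_field_derivative_unique_within:
  fixes f :: "real \<Rightarrow> real"
  assumes "at t within I \<noteq> bot"
    "(f has_real_derivative A) (at t within I)" "(f has_real_derivative B) (at t within I)"
  shows "A = B"
  using assms vector_derivative_unique_within
  by (metis has_real_derivative_iff_has_vector_derivative)

text \<open>The product form in \<open>ennreal\<close> avoids division, so an infinite risk or
  Fisher information causes no case distinction.\<close>

lemma cramer_rao:
  fixes p :: "'x \<Rightarrow> real \<Rightarrow> real"
  assumes nontriv: "at t0 within I \<noteq> bot" and t0: "t0 \<in> I"
    and meas [measurable]: "\<And>t. t \<in> I \<Longrightarrow> (\<lambda>x. p x t) \<in> borel_measurable \<mu>"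
    and nonneg: "\<And>x t. x \<in> space \<mu> \<Longrightarrow> t \<in> I \<Longrightarrow> 0 \<le> p x t"
    and prob: "\<And>t. t \<in> I \<Longrightarrow> prob_space (density \<mu> (\<lambda>x. ennreal (p x t)))"
    and T [measurable]: "T \<in> borel_measurable \<mu>"
    and regular: "cramer_rao_regular \<mu> p I T t0"
    and unbiased: "locally_unbiased \<mu> p I T t0"
  shows "1 \<le> (\<integral>\<^sup>+ x. ennreal ((T x - t0)\<^sup>2) \<partial>density \<mu> (\<lambda>x. ennreal (p x t0))) * fisher_info \<mu> p I t0"
proof -
  let ?Q = "density \<mu> (\<lambda>x. ennreal (p x t0))"
  let ?D = "\<lambda>x. vector_derivative (p x) (at t0 within I)"
  obtain U where U: "openin (top_of_set I) U" "t0 \<in> U"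
    and supp: "\<forall>t\<in>U. {x \<in> space \<mu>. 0 < p x t} = {x \<in> space \<mu>. 0 < p x t0}"
    and diff_U: "\<forall>x\<in>space \<mu>. \<forall>t\<in>U. p x differentiable (at t within I)"
    and diff1_U: "\<forall>t\<in>U. diff_under_integral \<mu> p I (\<lambda>_. 1) t"
    and diffT_U: "\<forall>t\<in>U. diff_under_integral \<mu> p I T t"
    using regular unfolding cramer_rao_regular_def by (elim exE conjE) (rule that)
  note diff = bspec[OF bspec[OF diff_U] U(2)]
    and diff1 = bspec[OF diff1_U U(2)] and diffT = bspec[OF diffT_U U(2)]
  have U_sub: "U \<subseteq> I" using U(1) openin_imp_subset by blast
  have score: "vector_derivative (\<lambda>t. ln (p x t)) (at t0 within I) = ?D x / p x t0"
    and D_zero: "p x t0 = 0 \<Longrightarrow> ?D x = 0" if x: "x \<in> space \<mu>" for x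
  proof -
    have *: "0 < p x t \<longleftrightarrow> 0 < p x t0" "0 \<le> p x t" if "t \<in> U" for t
      using bspec[OF supp that] nonneg[OF x subsetD[OF U_sub that]] x by (blast, simp)
    note ln_within = vector_derivative_ln_within[where q = "p x", OF nontriv U *(1,2) diff[OF x]]
    show "vector_derivative (\<lambda>t. ln (p x t)) (at t0 within I) = ?D x / p x t0"
      by (rule ln_within(1))
    show "p x t0 = 0 \<Longrightarrow> ?D x = 0"
      by (rule ln_within(2))
  qed
  have int1: "integrable \<mu> ?D" and intT: "integrable \<mu> (\<lambda>x. T x * ?D x)"
    using diff1 diffT by (simp_all add: diff_under_integral_def)
  note [measurable] = borel_measurable_integrable[OF int1] meas[OF t0]
  \<comment> \<open>The total mass is 1 throughout \<open>I\<close>, so its derivative, computed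
    under the integral sign, is 0.\<close>
  have "(\<integral>x. ?D x \<partial>\<mu>) = 0"
  proof (rule has_field_derivative_unique_within[OF nontriv])
    show "((\<lambda>s. \<integral>x. p x s \<partial>\<mu>) has_real_derivative (\<integral>x. ?D x \<partial>\<mu>)) (at t0 within I)"
      using diff1 by (simp add: diff_under_integral_def)
    have "(\<integral>x. p x s \<partial>\<mu>) = 1" if s: "s \<in> I" for s
    proof -
      have "(\<integral>x. 1 \<partial>density \<mu> (\<lambda>x. ennreal (p x s))) = (\<integral>x. p x s * 1 \<partial>\<mu>)"
        using s nonneg by (subst integral_density) (auto intro: meas)
      then show ?thesis using prob_space.prob_space[OF prob[OF s]] by simp
    qed
    then show "((\<lambda>s. \<integral>x. p x s \<partial>\<mu>) has_real_derivative 0) (at t0 within I)"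
      by (intro has_field_derivative_transform_within[OF DERIV_const[of 1] zero_less_one t0]) simp
  qed
  \<comment> \<open>The mean of \<open>T\<close> has two derivatives at \<open>t0\<close>: one by
    differentiation under the integral sign, the other, equal to 1, by local unbiasedness.
    Uniqueness identifies them.\<close>
  moreover have "(\<integral>x. T x * ?D x \<partial>\<mu>) = 1"
  proof (rule has_field_derivative_unique_within[OF nontriv])
    show "((\<lambda>s. \<integral>x. T x * p x s \<partial>\<mu>) has_real_derivative (\<integral>x. T x * ?D x \<partial>\<mu>)) (at t0 within I)"
      using diffT by (simp add: diff_under_integral_def)
    have eq: "(\<integral>x. T x \<partial>density \<mu> (\<lambda>x. ennreal (p x s))) = (\<integral>x. T x * p x s \<partial>\<mu>)"
      if s: "s \<in> I" for s
      using s nonneg by (subst integral_density) (auto intro: meas simp: mult.commute)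
    have "((\<lambda>s. \<integral>x. T x \<partial>density \<mu> (\<lambda>x. ennreal (p x s))) has_real_derivative 1) (at t0 within I)"
      using unbiased by (simp add: locally_unbiased_def)
    then show "((\<lambda>s. \<integral>x. T x * p x s \<partial>\<mu>) has_real_derivative 1) (at t0 within I)"
      by (rule has_field_derivative_transform_within[OF _ zero_less_one t0]) (use eq in auto)
  qed
  \<comment> \<open>Since \<open>?D\<close> integrates to 0, centring \<open>T\<close> at
    \<open>t0\<close> does not change the integral.\<close>
  ultimately have "(\<integral>x. (T x - t0) * ?D x \<partial>\<mu>) = 1"
    using int1 intT by (simp add: left_diff_distrib)
  moreover have "integrable \<mu> (\<lambda>x. (T x - t0) * ?D x)"
    using int1 intT by (simp add: left_diff_distrib)
  ultimately have "1 \<le> (\<integral>\<^sup>+ x. ennreal (norm ((T x - t0) * ?D x)) \<partial>\<mu>)"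
    using integral_norm_bound_ennreal by fastforce
  \<comment> \<open>To pass from \<open>\<mu>\<close> to the law \<open>?Q\<close>, the derivative
    is written as density times score. Where the density is 0 this relies on
    \<open>D_zero\<close>.\<close>
  also have "\<dots> = (\<integral>\<^sup>+ x. ennreal (p x t0) * (ennreal \<bar>T x - t0\<bar> * ennreal \<bar>?D x / p x t0\<bar>) \<partial>\<mu>)"
  proof (rule nn_integral_cong)
    fix x assume x: "x \<in> space \<mu>"
    show "ennreal (norm ((T x - t0) * ?D x)) =
        ennreal (p x t0) * (ennreal \<bar>T x - t0\<bar> * ennreal \<bar>?D x / p x t0\<bar>)"
      using D_zero[OF x] nonneg[OF x t0]
      by (cases "p x t0 = 0") (auto simp: abs_mult ennreal_mult[symmetric])
  qed
  also have "\<dots> = (\<integral>\<^sup>+ x. ennreal \<bar>T x - t0\<bar> * ennreal \<bar>?D x / p x t0\<bar> \<partial>?Q)"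
    by (subst nn_integral_density) auto
  finally have "1\<^sup>2 \<le> (\<integral>\<^sup>+ x. ennreal \<bar>T x - t0\<bar> * ennreal \<bar>?D x / p x t0\<bar> \<partial>?Q)\<^sup>2"
    by (intro power_mono) auto
  also have "\<dots> \<le> (\<integral>\<^sup>+ x. (ennreal \<bar>T x - t0\<bar>)\<^sup>2 \<partial>?Q) * (\<integral>\<^sup>+ x. (ennreal \<bar>?D x / p x t0\<bar>)\<^sup>2 \<partial>?Q)"
    by (rule Cauchy_Schwarz_nn_integral) auto
  also have "(\<integral>\<^sup>+ x. (ennreal \<bar>?D x / p x t0\<bar>)\<^sup>2 \<partial>?Q) = fisher_info \<mu> p I t0"
    unfolding fisher_info_def by (rule nn_integral_cong) (auto simp: score ennreal_power power_divide)
  finally show ?thesis by (simp add: ennreal_power)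
qed

section \<open>The two-stage bound\<close>

text \<open>
  For functions that are not measurable, the integral is a lower integral and only superadditive.
\<close>

lemma nn_integral_add_le:
  assumes "\<And>h k. h \<in> borel_measurable M \<Longrightarrow> k \<in> borel_measurable M \<Longrightarrow> h \<le> f \<Longrightarrow> k \<le> g \<Longrightarrow>
      (\<integral>\<^sup>+ x. h x + k x \<partial>M) \<le> L"
  shows "(\<integral>\<^sup>+ x. f x \<partial>M) + (\<integral>\<^sup>+ x. g x \<partial>M) \<le> L"
proof -
  let ?S = "\<lambda>f. {h. simple_function M h \<and> h \<le> f}"
  have ne: "?S f \<noteq> {}" for f :: "'a \<Rightarrow> ennreal"
    by (auto intro!: exI[of _ "\<lambda>_. 0"] simp: le_fun_def)
  have "integral\<^sup>S M h + integral\<^sup>S M k \<le> L" if "h \<in> ?S f" "k \<in> ?S g" for h k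
  proof -
    have "integral\<^sup>S M h + integral\<^sup>S M k = (\<integral>\<^sup>+ x. h x + k x \<partial>M)"
      using that by (simp add: nn_integral_eq_simple_integral[symmetric] nn_integral_add
          borel_measurable_simple_function)
    also have "\<dots> \<le> L"
      using that by (intro assms) (auto intro: borel_measurable_simple_function)
    finally show ?thesis .
  qed
  \<comment> \<open>In \<open>ennreal\<close>, adding a constant commutes with suprema over nonempty
    sets. Applied to each summand in turn, this reduces the claim to pairs of simple
    minorants.\<close>
  then show ?thesis
    unfolding nn_integral_def ennreal_SUP_add_left[OF ne, symmetric]
      ennreal_SUP_add_right[OF ne]
    by (intro SUP_least)
qed

text \<open>\<open>Q\<close> need not be measurable, so its failures are first enclosed in a
  measurable null set \<open>A\<close>; avoiding \<open>A\<close> is a measurable property that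
  passes to the kernel.\<close>

lemma AE_bindD:
  assumes K: "K \<in> M \<rightarrow>\<^sub>M subprob_algebra N" and ne: "space M \<noteq> {}"
    and AE: "AE y in M \<bind> K. Q y"
  shows "AE x in M. AE y in K x. Q y"
proof -
  have sets: "sets (M \<bind> K) = sets N" using K ne by (intro sets_bind) (auto simp: sets_kernel)
  obtain A where A: "{y \<in> space (M \<bind> K). \<not> Q y} \<subseteq> A" "emeasure (M \<bind> K) A = 0" "A \<in> sets (M \<bind> K)"
    using AE_E[OF AE] .
  have "AE y in M \<bind> K. y \<notin> A"
    using A by (intro AE_not_in) (auto simp: null_sets_def)
  then have "AE x in M. AE y in K x. y \<notin> A"
    using A(3) K by (subst (asm) AE_bind[where B = N]) (auto simp: sets)
  \<comment> \<open>\<open>A\<close> covers the failures of \<open>Q\<close> only inside the space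
    of the mixture, so the spaces must agree.\<close>
  moreover have "AE x in M. space (K x) = space (M \<bind> K)"
    using sets_kernel[OF K] sets by (intro AE_I2) (metis sets_eq_imp_space_eq)
  ultimately show ?thesis
  proof eventually_elim
    case (elim x)
    show ?case using elim(1) by (rule AE_mp) (use A(1) elim(2) in \<open>auto intro!: AE_I2\<close>)
  qed
qed

text \<open>Two comparisons in a row: Cramer-Rao bounds the risk of the lift, and the circular error
  is at least the error of the lift because both lift and \<open>\<theta>0\<close> lie in one
  interval of length \<open>pi / 2\<close>.\<close>

lemma conditional_risk_ge:
  assumes phase: "\<theta>0 \<in> circle"
    and protocol: "two_stage_protocol MZ MX PZ K \<theta>1"
    and model: "conditional_model MZ MX K \<theta>1 \<theta>0 \<mu> p"
    and estimator: "est \<in> MZ \<Otimes>\<^sub>M MX \<rightarrow>\<^sub>M circle_borel"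
    and z: "z \<in> coverage MZ \<theta>1 \<theta>0"
    and in_window: "AE x in K \<theta>0 z. est (z, x) \<in> window \<theta>1 z"
    and regular: "cramer_rao_regular (\<mu> z) (p z) (lift_interval \<theta>1 \<theta>0 z)
      (lifted_estimator \<theta>1 est \<theta>0 z) \<theta>0"
    and unbiased: "locally_unbiased (\<mu> z) (p z) (lift_interval \<theta>1 \<theta>0 z)
      (lifted_estimator \<theta>1 est \<theta>0 z) \<theta>0"
    and pos: "0 < fisher_info (\<mu> z) (p z) (lift_interval \<theta>1 \<theta>0 z) \<theta>0"
  shows "1 / fisher_info (\<mu> z) (p z) (lift_interval \<theta>1 \<theta>0 z) \<theta>0 \<le>
    (\<integral>\<^sup>+ x. ennreal ((geo_dist (est (z, x)) \<theta>0)\<^sup>2) \<partial>K \<theta>0 z)"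
proof -
  let ?I = "lift_interval \<theta>1 \<theta>0 z" and ?T = "lifted_estimator \<theta>1 est \<theta>0 z"
  let ?R = "\<integral>\<^sup>+ x. ennreal ((?T x - \<theta>0)\<^sup>2) \<partial>K \<theta>0 z"
  have z_space: "z \<in> space MZ" and cover: "\<theta>0 \<in> window \<theta>1 z"
    using z by (auto simp: coverage_def)
  obtain a where \<theta>0: "\<theta>0 \<in> {a..a + pi / 2}" and I: "?I = {a..a + pi / 2}"
    and img: "circle_proj ` {a..a + pi / 2} = window \<theta>1 z"
    by (rule lift_interval_eq_Icc[OF phase cover])
  have t0: "\<theta>0 \<in> ?I" using \<theta>0 I by simp
  have sets: "sets (\<mu> z) = sets MX"
    and p_meas: "\<And>t. t \<in> ?I \<Longrightarrow> (\<lambda>x. p z x t) \<in> borel_measurable (\<mu> z)"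
    and p_nonneg: "\<And>x t. x \<in> space (\<mu> z) \<Longrightarrow> t \<in> ?I \<Longrightarrow> 0 \<le> p z x t"
    and p_dens: "\<And>t. t \<in> ?I \<Longrightarrow> K (circle_proj t) z = density (\<mu> z) (\<lambda>x. ennreal (p z x t))"
    using model z unfolding conditional_model_def by auto
  have Q: "density (\<mu> z) (\<lambda>x. ennreal (p z x \<theta>0)) = K \<theta>0 z"
    using p_dens[OF t0] circle_proj_idem[OF phase] by simp
  have prob: "prob_space (density (\<mu> z) (\<lambda>x. ennreal (p z x t)))" if "t \<in> ?I" for t
  proof -
    have "K (circle_proj t) \<in> MZ \<rightarrow>\<^sub>M prob_algebra MX"
      using protocol circle_proj_in_circle by (auto simp: two_stage_protocol_def)
    from measurable_space[OF this z_space] show ?thesis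
      using p_dens[OF that] by (simp add: space_prob_algebra)
  qed
  \<comment> \<open>\<open>\<theta>0\<close> may be an end point of the lifted window; a
    nondegenerate interval has no isolated points, so one-sided derivatives are still
    unique.\<close>
  have nontriv: "at \<theta>0 within ?I \<noteq> bot"
    unfolding I trivial_limit_within using islimpt_Icc[of a "a + pi / 2" \<theta>0] \<theta>0 by simp
  have "est \<in> borel_measurable (MZ \<Otimes>\<^sub>M MX)"
    using estimator by (simp add: circle_borel_def measurable_restrict_space2_iff)
  then have "(\<lambda>x. est (z, x)) \<in> borel_measurable (\<mu> z)"
    using z_space unfolding measurable_cong_sets[OF sets refl] by simp
  then have T_meas: "?T \<in> borel_measurable (\<mu> z)"
    unfolding lifted_estimator_def I
    by (rule measurable_compose[OF _ borel_measurable_the_inv_into_circle_proj]) simp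
  have "1 \<le> ?R * fisher_info (\<mu> z) (p z) ?I \<theta>0"
    using cramer_rao[where \<mu> = "\<mu> z" and p = "p z" and T = ?T, OF nontriv t0 p_meas p_nonneg prob
        T_meas regular unbiased]
    unfolding Q .
  \<comment> \<open>Positivity excludes the quotient \<open>1 / 0\<close>, which is infinite in
    \<open>ennreal\<close>.\<close>
  then have "1 / fisher_info (\<mu> z) (p z) ?I \<theta>0 \<le> ?R"
    using pos by (intro divide_le_posI_ennreal) (auto simp: mult.commute)
  also have "\<dots> \<le> (\<integral>\<^sup>+ x. ennreal ((geo_dist (est (z, x)) \<theta>0)\<^sup>2) \<partial>K \<theta>0 z)"
  proof (rule nn_integral_mono_AE, use in_window in eventually_elim)
    fix x assume x: "est (z, x) \<in> window \<theta>1 z"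
    have inj: "inj_on circle_proj {a..a + pi / 2}" by (rule inj_on_circle_proj) simp
    have T_in: "?T x \<in> {a..a + pi / 2}"
      using the_inv_into_into[OF inj _ subset_refl] x img by (simp add: lifted_estimator_def I)
    have T_proj: "circle_proj (?T x) = est (z, x)"
      using f_the_inv_into_f[OF inj] x img by (simp add: lifted_estimator_def I)
    have "\<bar>?T x - \<theta>0\<bar> \<le> pi" using T_in \<theta>0 pi_gt_zero by (auto simp del: pi_gt_zero)
    then have "\<bar>?T x - \<theta>0\<bar> \<le> geo_dist (est (z, x)) \<theta>0"
      using abs_diff_le_geo_dist_circle_proj T_proj by metis
    then show "ennreal ((?T x - \<theta>0)\<^sup>2) \<le> ennreal ((geo_dist (est (z, x)) \<theta>0)\<^sup>2)"
      by (intro ennreal_leI) (metis abs_le_square_iff abs_of_nonneg geo_dist_nonneg)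
  qed
  finally show ?thesis .
qed

section \<open>Integration over the Stage I outcome\<close>

theorem mainTheorem1:
  fixes MZ :: "'z measure" and MX :: "'x measure"
    and PZ :: "real \<Rightarrow> 'z measure" and K :: "real \<Rightarrow> 'z \<Rightarrow> 'x measure"
    and \<theta>1 :: "'z \<Rightarrow> real" and est :: "'z \<times> 'x \<Rightarrow> real"
    and \<mu> :: "'z \<Rightarrow> 'x measure" and p :: "'z \<Rightarrow> 'x \<Rightarrow> real \<Rightarrow> real"
    and \<theta>0 :: real
  defines "P \<equiv> joint_law MZ MX PZ K \<theta>0"
    and "C \<equiv> coverage MZ \<theta>1 \<theta>0"
    and "I \<equiv> lift_interval \<theta>1 \<theta>0"
    and "T \<equiv> lifted_estimator \<theta>1 est \<theta>0"
  assumes phase: "\<theta>0 \<in> circle"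
    and protocol: "two_stage_protocol MZ MX PZ K \<theta>1"
    and model: "conditional_model MZ MX K \<theta>1 \<theta>0 \<mu> p"
    and estimator: "est \<in> MZ \<Otimes>\<^sub>M MX \<rightarrow>\<^sub>M circle_borel"
    and in_window: "AE (z, x) in P. est (z, x) \<in> window \<theta>1 z"
    and regular: "AE z in PZ \<theta>0. z \<in> C \<longrightarrow> cramer_rao_regular (\<mu> z) (p z) (I z) (T z) \<theta>0"
    and unbiased: "AE z in PZ \<theta>0. z \<in> C \<longrightarrow> locally_unbiased (\<mu> z) (p z) (I z) (T z) \<theta>0"
    and fisher: "AE z in PZ \<theta>0. z \<in> C \<longrightarrow>
      0 < fisher_info (\<mu> z) (p z) (I z) \<theta>0 \<and> fisher_info (\<mu> z) (p z) (I z) \<theta>0 < \<infinity>"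
  shows "(\<integral>\<^sup>+ (z, x). ennreal ((geo_dist (est (z, x)) \<theta>0)\<^sup>2) \<partial>P) \<ge>
      (\<integral>\<^sup>+ (z, x). (if z \<in> C then 1 / fisher_info (\<mu> z) (p z) (I z) \<theta>0 else 0) \<partial>P) +
      (\<integral>\<^sup>+ (z, x). ennreal ((overshoot \<theta>1 \<theta>0 z)\<^sup>2) \<partial>P)"
proof -
  let ?J = "\<lambda>z. fisher_info (\<mu> z) (p z) (I z) \<theta>0"
  let ?N = "\<lambda>z. distr (K \<theta>0 z) (MZ \<Otimes>\<^sub>M MX) (Pair z)"
  let ?d = "\<lambda>(z, x). ennreal ((geo_dist (est (z, x)) \<theta>0)\<^sup>2)"
  have PZ: "prob_space (PZ \<theta>0)" "sets (PZ \<theta>0) = sets MZ"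
    using protocol phase by (auto simp: two_stage_protocol_def space_prob_algebra)
  have PZ_space [simp]: "space (PZ \<theta>0) = space MZ" using PZ(2) by (rule sets_eq_imp_space_eq)
  \<comment> \<open>On an empty space \<open>bind\<close> takes a default value, so nonemptiness is
    needed to identify the sets of \<open>P\<close>.\<close>
  have PZ_ne: "space (PZ \<theta>0) \<noteq> {}" by (rule prob_space.not_empty[OF PZ(1)])
  have K_prob: "K \<theta>0 \<in> MZ \<rightarrow>\<^sub>M prob_algebra MX"
    using protocol phase by (auto simp: two_stage_protocol_def)
  have Kz: "prob_space (K \<theta>0 z)" "sets (K \<theta>0 z) = sets MX" if "z \<in> space MZ" for z
    using measurable_space[OF K_prob that] by (auto simp: space_prob_algebra)
  have Pair_meas: "Pair z \<in> K \<theta>0 z \<rightarrow>\<^sub>M MZ \<Otimes>\<^sub>M MX" if "z \<in> space MZ" for z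
    using that unfolding measurable_cong_sets[OF Kz(2)[OF that] refl] by simp
  have "?N \<in> MZ \<rightarrow>\<^sub>M subprob_algebra (MZ \<Otimes>\<^sub>M MX)"
    by (rule measurable_distr2[OF _ measurable_prob_algebraD[OF K_prob]]) simp
  then have N: "?N \<in> PZ \<theta>0 \<rightarrow>\<^sub>M subprob_algebra (MZ \<Otimes>\<^sub>M MX)"
    unfolding measurable_cong_sets[OF PZ(2) refl] .
  have P_eq: "P = PZ \<theta>0 \<bind> ?N" by (simp add: P_def joint_law_def)
  have sets_P: "sets P = sets (MZ \<Otimes>\<^sub>M MX)"
    unfolding P_eq by (rule sets_bind) (use PZ_ne in auto)
  have int_P: "(\<integral>\<^sup>+ y. f y \<partial>P) = (\<integral>\<^sup>+ z. \<integral>\<^sup>+ x. f (z, x) \<partial>K \<theta>0 z \<partial>PZ \<theta>0)"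
    if f: "f \<in> borel_measurable (MZ \<Otimes>\<^sub>M MX)" for f
  proof -
    have "(\<integral>\<^sup>+ y. f y \<partial>P) = (\<integral>\<^sup>+ z. \<integral>\<^sup>+ y. f y \<partial>?N z \<partial>PZ \<theta>0)"
      unfolding P_eq by (rule nn_integral_bind[OF f N])
    also have "\<dots> = (\<integral>\<^sup>+ z. \<integral>\<^sup>+ x. f (z, x) \<partial>K \<theta>0 z \<partial>PZ \<theta>0)"
      by (rule nn_integral_cong) (simp add: nn_integral_distr Pair_meas f)
    finally show ?thesis .
  qed
  \<comment> \<open>The window condition under the joint law is disintegrated: for almost every
    \<open>z\<close> it holds almost surely under the Stage II law.\<close>
  have "AE z in PZ \<theta>0. AE y in ?N z. (case y of (z, x) \<Rightarrow> est (z, x) \<in> window \<theta>1 z)"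
    using in_window unfolding P_eq by (rule AE_bindD[OF N PZ_ne])
  moreover have "AE z in PZ \<theta>0. z \<in> space MZ" by (rule AE_I2) simp
  ultimately have window: "AE z in PZ \<theta>0. AE x in K \<theta>0 z. est (z, x) \<in> window \<theta>1 z"
  proof eventually_elim
    case (elim z)
    show ?case using AE_distrD[OF Pair_meas[OF elim(2)] elim(1)] by simp
  qed
  have est: "est \<in> borel_measurable (MZ \<Otimes>\<^sub>M MX)"
    using estimator by (simp add: circle_borel_def measurable_restrict_space2_iff)
  then have d_meas: "?d \<in> borel_measurable (MZ \<Otimes>\<^sub>M MX)" by simp
  show ?thesis
  proof (rule nn_integral_add_le)
    \<comment> \<open>The minorants live on the product space and may depend on \<open>x\<close>,
      although their upper bounds depend on \<open>z\<close> only. Their measurability lets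
      \<open>int_P\<close> apply to the sum.\<close>
    fix h k :: "'z \<times> 'x \<Rightarrow> ennreal"
    assume h: "h \<in> borel_measurable P" "h \<le> (\<lambda>(z, x). if z \<in> C then 1 / ?J z else 0)"
      and k: "k \<in> borel_measurable P" "k \<le> (\<lambda>(z, x). ennreal ((overshoot \<theta>1 \<theta>0 z)\<^sup>2))"
    have h_le: "h (z, x) \<le> (if z \<in> C then 1 / ?J z else 0)" for z x
      using le_funD[OF h(2), of "(z, x)"] by simp
    have k_le: "k (z, x) \<le> ennreal ((overshoot \<theta>1 \<theta>0 z)\<^sup>2)" for z x
      using le_funD[OF k(2), of "(z, x)"] by simp
    have "(\<lambda>y. h y + k y) \<in> borel_measurable (MZ \<Otimes>\<^sub>M MX)"
      using h(1) k(1) unfolding measurable_cong_sets[OF sets_P refl] by simp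
    then have "(\<integral>\<^sup>+ y. h y + k y \<partial>P) = (\<integral>\<^sup>+ z. \<integral>\<^sup>+ x. h (z, x) + k (z, x) \<partial>K \<theta>0 z \<partial>PZ \<theta>0)"
      by (rule int_P)
    also have "\<dots> \<le> (\<integral>\<^sup>+ z. \<integral>\<^sup>+ x. ?d (z, x) \<partial>K \<theta>0 z \<partial>PZ \<theta>0)"
    proof (rule nn_integral_mono_AE)
      show "AE z in PZ \<theta>0. (\<integral>\<^sup>+ x. h (z, x) + k (z, x) \<partial>K \<theta>0 z) \<le> (\<integral>\<^sup>+ x. ?d (z, x) \<partial>K \<theta>0 z)"
        using window regular unbiased fisher AE_space
      proof eventually_elim
        case (elim z)
        then have z: "z \<in> space MZ" by simp
        show ?case
        proof (cases "z \<in> C")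
          \<comment> \<open>The overshoot is 0 here, and the constant \<open>1 / ?J z\<close>
            integrates to itself under a probability measure.\<close>
          case True
          then have "h (z, x) + k (z, x) \<le> 1 / ?J z" for x
            using add_mono[OF h_le[of z x] k_le[of z x]] overshoot_eq_0[of \<theta>0 \<theta>1 z]
            by (simp add: C_def coverage_def)
          then have "(\<integral>\<^sup>+ x. h (z, x) + k (z, x) \<partial>K \<theta>0 z) \<le> (\<integral>\<^sup>+ x. 1 / ?J z \<partial>K \<theta>0 z)"
            by (intro nn_integral_mono)
          also have "\<dots> = 1 / ?J z"
            by (simp add: prob_space.emeasure_space_1[OF Kz(1)[OF z]])
          also have "\<dots> \<le> (\<integral>\<^sup>+ x. ?d (z, x) \<partial>K \<theta>0 z)"
            using conditional_risk_ge[OF phase protocol model estimator, of z] elim True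
            by (simp add: C_def I_def T_def)
          finally show ?thesis .
        next
          \<comment> \<open>Here \<open>h\<close> vanishes, and what remains is the overshoot bound
            for estimates in the window.\<close>
          case False
          show ?thesis
          proof (rule nn_integral_mono_AE, use elim(1) in eventually_elim)
            fix x assume "est (z, x) \<in> window \<theta>1 z"
            then have "overshoot \<theta>1 \<theta>0 z \<le> geo_dist (est (z, x)) \<theta>0"
              unfolding overshoot_def by (rule geo_setdist_le)
            then have "ennreal ((overshoot \<theta>1 \<theta>0 z)\<^sup>2) \<le> ?d (z, x)"
              by (auto intro!: ennreal_leI power_mono overshoot_nonneg)
            then show "h (z, x) + k (z, x) \<le> ?d (z, x)"
              using h_le[of z x] order_trans[OF k_le[of z x]] False by simp
          qed
        qed
      qed
    qed
    also have "\<dots> = (\<integral>\<^sup>+ y. ?d y \<partial>P)" by (rule int_P[OF d_meas, symmetric])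
    finally show "(\<integral>\<^sup>+ y. h y + k y \<partial>P) \<le> (\<integral>\<^sup>+ y. ?d y \<partial>P)" .
  qed
qed

end
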